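(* Let $G=(\mathcal V,\mathcal E)$ be a connected graph and let $\mathcal V_1\cup\mathcal V_2$ be a non-trivial partition of $\mathcal V$ (i.e. $\mathcal V_1,\mathcal V_2$ are disjoint, non-empty, with union $\mathcal V$). Then the set $$\mathcal N_{\mathcal V_1}(G)=\{\mu\in\mathcal M(\mathcal V):\ \forall\, U_1\subset\mathcal V_1 \text{ with } U_1\ne\emptyset,\ \mu(U_1)<\mu(\mathcal E(U_1))\}$$ coincides with the set $$\mathcal W_{\prec,\mathcal V_2}(G)=\bigl\{\mu\in\mathcal M(\mathcal V):\ \exists\,\alpha\in\mathcal M(\mathcal E)\text{ such that } \mu^\alpha(i)=\mu(i)\ \forall i\in\mathcal V_1\ \text{ and }\ \mu^\alpha(j)<\mu(j)\ \forall j\in\mathcal V_2\bigr\}.$$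
   Context: A graph $G=(\mathcal V,\mathcal E)$ is finite, undirected, without self-loops, with $\mathcal E\subset\mathcal V\times\mathcal V$ symmetric. For $U\subset\mathcal V$, $\mathcal E(U)=\{v\in\mathcal V:\exists u\in U,\ (u,v)\in\mathcal E\}$ and $\mathcal E(u)=\mathcal E(\{u\})$. $\mathcal M(\mathcal V)$ is the set of positive measures with full support on $\mathcal V$. $\mathcal M(\mathcal E)$ is the set of families of weights $\alpha=(\alpha_{i,j})_{(i,j)\in\mathcal E}$ with $\alpha_{i,j}=\alpha_{j,i}>0$; for such $\alpha$, $\mu^\alpha(i)=\sum_{j\in\mathcal E(i)}\alpha_{i,j}$ for $i\in\mathcal V$. *)

theory Defs
  imports "HOL-Analysis.Measure_Space" "Graph_Theory.Graph_Theory"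
begin

text \<open>
  A finite undirected loop-free graph is a \<open>pair_graph\<close>. The neighbourhood of a vertex set
  \<open>U\<close> is the relational image \<open>parcs G `` U\<close>.
\<close>

text \<open>
  Every subset of the finite discrete vertex set is measurable, and full support means that each
  vertex carries positive mass. Measures are finite, so that the real-valued \<open>measure\<close> agrees
  with \<open>emeasure\<close>.
\<close>
definition full_support_measures :: "'a set \<Rightarrow> 'a measure set" where
  "full_support_measures V =
     {\<mu>. space \<mu> = V \<and> sets \<mu> = Pow V \<and> finite_measure \<mu> \<and> (\<forall>v\<in>V. 0 < measure \<mu> {v})}"

definition edge_weights :: "('a \<times> 'a) set \<Rightarrow> ('a \<times> 'a \<Rightarrow> real) set" where
  "edge_weights E = {\<alpha> \<in> E \<rightarrow>\<^sub>E {0<..}. \<forall>(i, j)\<in>E. \<alpha> (i, j) = \<alpha> (j, i)}"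

definition weight_marginal :: "('a \<times> 'a) set \<Rightarrow> ('a \<times> 'a \<Rightarrow> real) \<Rightarrow> 'a \<Rightarrow> real" where
  "weight_marginal E \<alpha> i = (\<Sum>j\<in>E `` {i}. \<alpha> (i, j))"

definition Ncond :: "'a pair_pre_digraph \<Rightarrow> 'a set \<Rightarrow> 'a measure set" where
  "Ncond G V1 =
     {\<mu> \<in> full_support_measures (pverts G).
        \<forall>U1 \<subseteq> V1. U1 \<noteq> {} \<longrightarrow> measure \<mu> U1 < measure \<mu> (parcs G `` U1)}"

text \<open>The equality constraints are imposed on the complement of \<open>V2\<close> in the vertex set.\<close>
definition Wprec :: "'a pair_pre_digraph \<Rightarrow> 'a set \<Rightarrow> 'a measure set" where
  "Wprec G V2 =
     {\<mu> \<in> full_support_measures (pverts G).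
        \<exists>\<alpha> \<in> edge_weights (parcs G).
          (\<forall>i \<in> pverts G - V2. weight_marginal (parcs G) \<alpha> i = measure \<mu> {i}) \<and>
          (\<forall>j \<in> V2. weight_marginal (parcs G) \<alpha> j < measure \<mu> {j})}"

end

theory Submission
  imports Defs
begin

text \<open>
  If \<open>\<alpha>\<close> has the prescribed marginals and \<open>U \<subseteq> V1\<close>, then the weight
  seen from \<open>U\<close> is at most the weight seen from its neighbourhood \<open>N(U)\<close>, since every edge
  leaving \<open>U\<close> arrives in \<open>N(U)\<close>. Equality would force all edges at \<open>N(U)\<close> to return to \<open>U\<close> and
  \<open>N(U)\<close> to avoid \<open>V2\<close>; then \<open>U \<union> N(U)\<close> is a union of components inside \<open>V1\<close>, which
  connectedness excludes. This is \<open>sum_less_neighbours\<close>.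

  Conversely, weights for \<open>\<mu>\<close> amount to writing it as a strictly positive combination of the edge
  vectors \<open>1\<^sub>u + 1\<^sub>v\<close> and the slack vectors \<open>1\<^sub>w\<close> with \<open>w \<in> V2\<close>. By linear programming duality
  (\<open>farkas_sum\<close>, in the strict form \<open>positive_combination\<close>) such a combination exists unless some
  \<open>y\<close> that does not vanish on all generators satisfies \<open>y\<^sub>u + y\<^sub>v \<ge> 0\<close> on edges, \<open>y \<ge> 0\<close> on
  \<open>V2\<close> and \<open>\<Sum> y\<^sub>i \<mu>\<^sub>i \<le> 0\<close>. The strict neighbourhood inequality excludes this obstruction
  (\<open>dual_vector_trivial\<close>): raising \<open>y\<close> on the set \<open>N\<close> of its negative vertices and lowering it by
  the same amount on the neighbourhood of \<open>N\<close> strictly decreases \<open>\<Sum> y\<^sub>i \<mu>\<^sub>i\<close> and preserves all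
  constraints, and finitely many such moves lead to a nonnegative \<open>y\<close>.
\<close>

section \<open>Positive combinations and duality\<close>

text \<open>
  Farkas' lemma, by Bartl's induction on the number of generators. If the new generator \<open>g k\<close> is
  indispensable, some \<open>x\<close> pairs nonnegatively with the old generators but negatively with \<open>b\<close> and
  hence with \<open>g k\<close>. Projecting along \<open>x\<close> onto the hyperplane where \<open>g k\<close> vanishes reduces the
  claim to the old generators, each shifted by a multiple of \<open>g k\<close>.
\<close>

lemma farkas_sum:
  fixes g :: "'j \<Rightarrow> 'i \<Rightarrow> real" and b :: "'i \<Rightarrow> real"
  assumes "finite J" and "finite I"
    and "\<And>y. \<forall>j\<in>J. 0 \<le> (\<Sum>i\<in>I. y i * g j i) \<Longrightarrow> 0 \<le> (\<Sum>i\<in>I. y i * b i)"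
  shows "\<exists>l. (\<forall>j\<in>J. 0 \<le> l j) \<and> (\<forall>i\<in>I. b i = (\<Sum>j\<in>J. l j * g j i))"
  using assms(1,3)
proof (induction J arbitrary: g b rule: finite_induct)
  case empty
  have "0 \<le> (\<Sum>i\<in>I. - b i * b i)" by (rule empty) simp
  then have "(\<Sum>i\<in>I. b i * b i) \<le> 0" by (simp add: sum_negf)
  then have "(\<Sum>i\<in>I. b i * b i) = 0" by (intro order_antisym sum_nonneg) auto
  then have "\<forall>i\<in>I. b i * b i = 0" using assms(2) by (subst (asm) sum_nonneg_eq_0_iff) auto
  then show ?case by auto
next
  case (insert k J)
  define dot where "dot y v = (\<Sum>i\<in>I. y i * v i)" for y v :: "'i \<Rightarrow> real"
  have dot_comb: "dot (\<lambda>i. y i + c * x i) v = dot y v + c * dot x v" for y c x v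
    by (simp add: dot_def sum.distrib sum_distrib_left algebra_simps)
  have dot_comb': "dot y (\<lambda>i. v i + c * w i) = dot y v + c * dot y w" for y c v w
    by (simp add: dot_def sum.distrib sum_distrib_left algebra_simps)
  have prem: "0 \<le> dot y b" if "0 \<le> dot y (g k)" "\<forall>j\<in>J. 0 \<le> dot y (g j)" for y
    using insert.prems[of y] that by (simp add: dot_def)
  show ?case
  proof (cases "\<forall>y. (\<forall>j\<in>J. 0 \<le> dot y (g j)) \<longrightarrow> 0 \<le> dot y b")
    case True
    then obtain l where "\<forall>j\<in>J. 0 \<le> l j" and l: "\<forall>i\<in>I. b i = (\<Sum>j\<in>J. l j * g j i)"
      using insert.IH[of g b] unfolding dot_def by blast
    moreover have "(\<Sum>j\<in>J. (l(k := 0)) j * g j i) = (\<Sum>j\<in>J. l j * g j i)" for i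
      using insert.hyps by (intro sum.cong) auto
    ultimately show ?thesis using insert.hyps
      by (intro exI[of _ "l(k := 0)"]) auto
  next
    case False
    then obtain x0 where x0: "\<forall>j\<in>J. 0 \<le> dot x0 (g j)" "dot x0 b < 0" by force
    then have neg: "dot x0 (g k) < 0" using prem[of x0] by force
    define x where "x i = x0 i / - dot x0 (g k)" for i
    have dot_x: "dot x v = dot x0 v / - dot x0 (g k)" for v
      by (simp only: x_def dot_def[of _ v] sum_divide_distrib times_divide_eq_left)
    have xk: "dot x (g k) = - 1" using neg by (simp add: dot_x)
    have xJ: "\<forall>j\<in>J. 0 \<le> dot x (g j)" using x0 neg by (auto simp: dot_x divide_nonneg_pos divide_nonneg_neg divide_le_0_iff)
    have xb: "dot x b < 0" using x0 neg by (simp add: dot_x divide_neg_pos zero_less_divide_iff)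
    let ?g = "\<lambda>j i. g j i + dot x (g j) * g k i"
    let ?b = "\<lambda>i. b i + dot x b * g k i"
    have adjoint: "dot (\<lambda>i. y i + dot y (g k) * x i) v = dot y (\<lambda>i. v i + dot x v * g k i)" for y v
      unfolding dot_comb dot_comb' by simp
    have "0 \<le> dot y ?b" if y: "\<forall>j\<in>J. 0 \<le> dot y (?g j)" for y
    proof -
      have "0 \<le> dot (\<lambda>i. y i + dot y (g k) * x i) b"
      proof (rule prem)
        show "0 \<le> dot (\<lambda>i. y i + dot y (g k) * x i) (g k)" by (simp add: dot_comb xk)
        show "\<forall>j\<in>J. 0 \<le> dot (\<lambda>i. y i + dot y (g k) * x i) (g j)"
          unfolding adjoint by (rule y)
      qed
      then show ?thesis unfolding adjoint .
    qed
    then obtain l where l: "\<forall>j\<in>J. 0 \<le> l j" "\<forall>i\<in>I. ?b i = (\<Sum>j\<in>J. l j * ?g j i)"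
      using insert.IH[of ?g ?b] unfolding dot_def by blast
    define c where "c = (\<Sum>j\<in>J. l j * dot x (g j)) - dot x b"
    have "0 \<le> (\<Sum>j\<in>J. l j * dot x (g j))" using l(1) xJ by (intro sum_nonneg) auto
    then have "0 \<le> c" using xb by (simp add: c_def)
    have "b i = c * g k i + (\<Sum>j\<in>J. l j * g j i)" if "i \<in> I" for i
      using l(2) that
      by (simp add: c_def sum.distrib sum_distrib_left sum_distrib_right algebra_simps)
    moreover have "(\<Sum>j\<in>J. (l(k := c)) j * g j i) = (\<Sum>j\<in>J. l j * g j i)" for i
      using insert.hyps by (intro sum.cong) auto
    ultimately show ?thesis using insert.hyps l(1) \<open>0 \<le> c\<close>
      by (intro exI[of _ "l(k := c)"]) auto
  qed
qed

text \<open>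
  A form of duality with strictly positive coefficients. It results from representing
  \<open>- (\<Sum>j\<in>J. g j)\<close> as a nonnegative combination of the generators and \<open>- b\<close>: moving the generators
  to one side makes each coefficient at least 1.
\<close>

lemma positive_combination:
  fixes g :: "'j \<Rightarrow> 'i \<Rightarrow> real" and b :: "'i \<Rightarrow> real"
  assumes J: "finite J" and I: "finite I"
    and dual: "\<And>y. \<lbrakk>\<forall>j\<in>J. 0 \<le> (\<Sum>i\<in>I. y i * g j i); (\<Sum>i\<in>I. y i * b i) \<le> 0\<rbrakk>
               \<Longrightarrow> \<forall>j\<in>J. (\<Sum>i\<in>I. y i * g j i) = 0"
  shows "\<exists>t l. 0 \<le> t \<and> (\<forall>j\<in>J. 0 < l j) \<and> (\<forall>i\<in>I. t * b i = (\<Sum>j\<in>J. l j * g j i))"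
proof -
  let ?h = "case_option (\<lambda>i. - b i) g"
  let ?J = "insert None (Some ` J)"
  let ?s = "\<lambda>i. - (\<Sum>j\<in>J. g j i)"
  have swap: "(\<Sum>i\<in>I. y i * ?s i) = - (\<Sum>j\<in>J. \<Sum>i\<in>I. y i * g j i)" for y
    by (simp add: sum_negf sum_distrib_left sum.swap[of _ J I])
  have "\<exists>l. (\<forall>j\<in>?J. 0 \<le> l j) \<and> (\<forall>i\<in>I. ?s i = (\<Sum>j\<in>?J. l j * ?h j i))"
  proof (rule farkas_sum)
    fix y :: "'i \<Rightarrow> real"
    assume "\<forall>j\<in>?J. 0 \<le> (\<Sum>i\<in>I. y i * ?h j i)"
    then have "\<forall>j\<in>J. (\<Sum>i\<in>I. y i * g j i) = 0"
      by (intro dual) (auto simp: sum_negf)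
    then show "0 \<le> (\<Sum>i\<in>I. y i * ?s i)" by (simp only: swap) simp
  qed (use J I in auto)
  then obtain l where l: "\<forall>j\<in>?J. 0 \<le> l j" "\<forall>i\<in>I. ?s i = (\<Sum>j\<in>?J. l j * ?h j i)" by blast
  have "l None * b i = (\<Sum>j\<in>J. (1 + l (Some j)) * g j i)" if "i \<in> I" for i
    using l(2) that J by (simp add: sum.reindex algebra_simps sum.distrib)
  then show ?thesis using l(1)
    by (intro exI[of _ "l None"] exI[of _ "\<lambda>j. 1 + l (Some j)"]) (auto intro: add_pos_nonneg)
qed

section \<open>Neighbourhood inequalities exclude dual obstructions\<close>

text \<open>
  The induction is on the number of negative entries. The step \<open>t\<close> is the smallest modulus of a
  negative entry: it makes at least one of these entries vanish, and the neighbours of negative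
  vertices, where \<open>y \<ge> t\<close>, stay nonnegative.
\<close>

lemma dual_vector_trivial:
  fixes m y :: "'a \<Rightarrow> real"
  assumes V: "finite V" and E: "E \<subseteq> V \<times> V" "sym E"
    and m: "\<forall>i\<in>V. 0 < m i"
    and hall: "\<And>U. \<lbrakk>U \<subseteq> V1; U \<noteq> {}\<rbrakk> \<Longrightarrow> sum m U < sum m (E `` U)"
    and "\<forall>i\<in>V - V1. 0 \<le> y i" and "\<forall>(i, j)\<in>E. 0 \<le> y i + y j"
  shows "0 \<le> (\<Sum>i\<in>V. y i * m i) \<and> ((\<Sum>i\<in>V. y i * m i) = 0 \<longrightarrow> (\<forall>i\<in>V. y i = 0))"
  using assms(6,7)
proof (induction "card {i\<in>V. y i < 0}" arbitrary: y rule: less_induct)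
  case less
  define N where "N = {i\<in>V. y i < 0}"
  show ?case
  proof (cases "N = {}")
    case True
    then have "\<forall>i\<in>V. 0 \<le> y i * m i" using m by (force simp: N_def)
    then show ?thesis using V m by (fastforce simp: sum_nonneg sum_nonneg_eq_0_iff)
  next
    case False
    have fN: "finite N" using V by (simp add: N_def)
    define t where "t = Min ((\<lambda>i. - y i) ` N)"
    have t_le: "t \<le> - y i" if "i \<in> N" for i using that fN by (simp add: t_def)
    have "t \<in> (\<lambda>i. - y i) ` N" unfolding t_def using fN False by (intro Min_in) auto
    then obtain k where k: "k \<in> N" "t = - y k" by blast
    have "0 < t" using k by (simp add: N_def)
    have nb: "t \<le> y j" if "j \<in> E `` N" for j
      using that less.prems(2) t_le by force
    have disj: "N \<inter> E `` N = {}" using nb \<open>0 < t\<close> by (force simp: N_def)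
    have NV1: "N \<subseteq> V1" using less.prems(1) by (force simp: N_def)
    have sub: "N \<subseteq> V" "E `` N \<subseteq> V" using E(1) by (auto simp: N_def)
    define z where "z i = y i + t * (of_bool (i \<in> N) - of_bool (i \<in> E `` N))" for i
    have z_N: "z i = y i + t" "z i \<le> 0" if "i \<in> N" for i
      using that disj t_le[of i] by (auto simp: z_def)
    have z_nonneg: "0 \<le> z i" if "i \<in> V - N" for i
      using that nb[of i] by (auto simp: z_def N_def)
    have z_V1: "\<forall>i\<in>V - V1. 0 \<le> z i" using z_nonneg NV1 by auto
    have z_edge: "\<forall>(i, j)\<in>E. 0 \<le> z i + z j"
    proof clarify
      fix i j assume ij: "(i, j) \<in> E"
      then have ji: "(j, i) \<in> E" using E(2) by (auto dest: symD)
      have y: "0 \<le> y i + y j" using ij less.prems(2) by auto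
      consider "i \<in> N" | "j \<in> N" | "i \<in> V - N" "j \<in> V - N" using ij E(1) by auto
      then show "0 \<le> z i + z j"
      proof cases
        case 1
        then have "j \<in> E `` N" "j \<notin> N" using ij disj by auto
        then have "z j = y j - t" by (simp add: z_def)
        then show ?thesis using y z_N(1)[OF 1] by simp
      next
        case 2
        then have "i \<in> E `` N" "i \<notin> N" using ji disj by auto
        then have "z i = y i - t" by (simp add: z_def)
        then show ?thesis using y z_N(1)[OF 2] by simp
      next
        case 3
        then show ?thesis using z_nonneg by (simp add: add_nonneg_nonneg)
      qed
    qed
    have "{i\<in>V. z i < 0} \<subset> N"
    proof
      show "{i\<in>V. z i < 0} \<subseteq> N" using z_nonneg by force
      show "{i\<in>V. z i < 0} \<noteq> N" using k z_N(1)[of k] by auto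
    qed
    then have "card {i\<in>V. z i < 0} < card {i\<in>V. y i < 0}"
      using fN unfolding N_def by (rule psubset_card_mono[rotated])
    then have "0 \<le> (\<Sum>i\<in>V. z i * m i)" using less.hyps z_V1 z_edge by blast
    moreover have "(\<Sum>i\<in>V. z i * m i) = (\<Sum>i\<in>V. y i * m i) + t * (sum m N - sum m (E `` N))"
    proof -
      have ind: "(\<Sum>i\<in>V. of_bool (i \<in> S) * m i) = sum m S" if "S \<subseteq> V" for S
        using that V by (simp add: of_bool_def if_distrib[of "\<lambda>c. c * _"] sum.If_cases Int_absorb1
            cong: if_cong)
      have "(\<Sum>i\<in>V. z i * m i) = (\<Sum>i\<in>V. y i * m i)
          + t * ((\<Sum>i\<in>V. of_bool (i \<in> N) * m i) - (\<Sum>i\<in>V. of_bool (i \<in> E `` N) * m i))"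
        unfolding z_def
        by (simp only: algebra_simps sum.distrib sum_subtractf sum_distrib_left)
      then show ?thesis using ind sub by simp
    qed
    moreover have "t * (sum m N - sum m (E `` N)) < 0"
      using \<open>0 < t\<close> hall[OF NV1 False] by (simp add: mult_pos_neg)
    ultimately show ?thesis by linarith
  qed
qed

section \<open>Edge weights with prescribed marginals\<close>

lemma sum_arcs_tail:
  assumes "finite E"
  shows "(\<Sum>e\<in>E. f e * of_bool (fst e = i)) = (\<Sum>j\<in>E `` {i}. f (i, j) :: real)"
proof -
  have "(\<Sum>e\<in>E. f e * of_bool (fst e = i)) = (\<Sum>e\<in>{e\<in>E. fst e = i}. f e)"
    using assms by (intro sum.mono_neutral_cong_right) auto
  also have "{e\<in>E. fst e = i} = Pair i ` (E `` {i})" by force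
  finally show ?thesis by (simp add: sum.reindex inj_on_def)
qed

lemma sum_arcs_head:
  assumes "finite E" "sym E"
  shows "(\<Sum>e\<in>E. f e * of_bool (snd e = i)) = (\<Sum>j\<in>E `` {i}. f (j, i) :: real)"
proof -
  have "(\<Sum>e\<in>E. f e * of_bool (snd e = i)) = (\<Sum>e\<in>{e\<in>E. snd e = i}. f e)"
    using assms by (intro sum.mono_neutral_cong_right) auto
  also have "{e\<in>E. snd e = i} = (\<lambda>j. (j, i)) ` (E `` {i})" using assms(2) by (force dest: symD)
  finally show ?thesis by (simp add: sum.reindex inj_on_def)
qed

text \<open>
  The generators are the vectors \<open>1\<^sub>u + 1\<^sub>v\<close> for arcs \<open>(u, v)\<close> and \<open>1\<^sub>w\<close> for \<open>w \<in> V2\<close>. The two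
  orientations of an edge have independent coefficients, whose sum is the weight of the edge; the
  coefficient of \<open>1\<^sub>w\<close> is the defect at \<open>w\<close>. All of this is up to the common factor \<open>t\<close>.
\<close>

lemma edge_weights_exist:
  fixes m :: "'a \<Rightarrow> real"
  assumes V: "finite V" and E: "E \<subseteq> V \<times> V" "sym E"
    and m: "\<forall>i\<in>V. 0 < m i"
    and part: "V1 \<inter> V2 = {}" "V1 \<union> V2 = V" "V2 \<noteq> {}"
    and hall: "\<And>U. \<lbrakk>U \<subseteq> V1; U \<noteq> {}\<rbrakk> \<Longrightarrow> sum m U < sum m (E `` U)"
  shows "\<exists>\<alpha>\<in>edge_weights E. (\<forall>i\<in>V1. weight_marginal E \<alpha> i = m i) \<and>
           (\<forall>j\<in>V2. weight_marginal E \<alpha> j < m j)"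
proof -
  have fE: "finite E" using V E(1) by (meson finite_SigmaI finite_subset)
  have fV2: "finite V2" using V part by auto
  let ?g = "case_sum (\<lambda>(u, v) i. of_bool (u = i) + of_bool (v = i)) (\<lambda>w i. of_bool (w = i))
    :: ('a \<times> 'a) + 'a \<Rightarrow> 'a \<Rightarrow> real"
  have pair: "(\<Sum>i\<in>V. y i * of_bool (u = i)) = y u" if "u \<in> V" for y :: "'a \<Rightarrow> real" and u
    using that V by (simp add: of_bool_def if_distrib[of "\<lambda>c. _ * c"] cong: if_cong)
  have pair_edge: "(\<Sum>i\<in>V. y i * ?g (Inl (u, v)) i) = y u + y v" if "(u, v) \<in> E" for y u v
    using that E(1) by (auto simp: distrib_left sum.distrib pair)
  have pair_slack: "(\<Sum>i\<in>V. y i * ?g (Inr w) i) = y w" if "w \<in> V2" for y w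
    using that part pair[of w y] by auto
  have "\<exists>t l. 0 \<le> t \<and> (\<forall>x\<in>E <+> V2. 0 < l x) \<and>
          (\<forall>i\<in>V. t * m i = (\<Sum>x\<in>E <+> V2. l x * ?g x i))"
  proof (rule positive_combination)
    fix y :: "'a \<Rightarrow> real"
    assume y: "\<forall>x\<in>E <+> V2. 0 \<le> (\<Sum>i\<in>V. y i * ?g x i)" and ym: "(\<Sum>i\<in>V. y i * m i) \<le> 0"
    have "0 \<le> y u + y v" if uv: "(u, v) \<in> E" for u v
    proof -
      have "0 \<le> (\<Sum>i\<in>V. y i * ?g (Inl (u, v)) i)" by (rule bspec[OF y]) (rule InlI[OF uv])
      then show ?thesis by (simp only: pair_edge[OF uv])
    qed
    then have "\<forall>(i, j)\<in>E. 0 \<le> y i + y j" by blast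
    moreover have "0 \<le> y w" if w: "w \<in> V2" for w
    proof -
      have "0 \<le> (\<Sum>i\<in>V. y i * ?g (Inr w) i)" by (rule bspec[OF y]) (rule InrI[OF w])
      then show ?thesis by (simp only: pair_slack[OF w])
    qed
    then have "\<forall>i\<in>V - V1. 0 \<le> y i" using part(2) by blast
    ultimately have "0 \<le> (\<Sum>i\<in>V. y i * m i) \<and> ((\<Sum>i\<in>V. y i * m i) = 0 \<longrightarrow> (\<forall>i\<in>V. y i = 0))"
      by (intro dual_vector_trivial[OF V E m hall])
    then have "\<forall>i\<in>V. y i = 0" using ym by simp
    then show "\<forall>x\<in>E <+> V2. (\<Sum>i\<in>V. y i * ?g x i) = 0" by simp
  qed (use fE fV2 V in auto)
  then obtain t l where t: "0 \<le> t" and l: "\<forall>x\<in>E <+> V2. 0 < l x"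
    and comb: "\<forall>i\<in>V. t * m i = (\<Sum>x\<in>E <+> V2. l x * ?g x i)" by blast
  define s where "s i = (if i \<in> V2 then l (Inr i) else 0)" for i
  have split: "t * m i = (\<Sum>j\<in>E `` {i}. l (Inl (i, j)) + l (Inl (j, i))) + s i"
    if "i \<in> V" for i
  proof -
    have "t * m i = (\<Sum>e\<in>E. l (Inl e) * ?g (Inl e) i) + (\<Sum>w\<in>V2. l (Inr w) * ?g (Inr w) i)"
      using comb that fE fV2 by (simp add: sum.Plus)
    also have "(\<Sum>w\<in>V2. l (Inr w) * ?g (Inr w) i) = s i"
      using fV2 by (simp add: s_def of_bool_def if_distrib[of "\<lambda>c. _ * c"] cong: if_cong)
    also have "(\<Sum>e\<in>E. l (Inl e) * ?g (Inl e) i)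
        = (\<Sum>e\<in>E. l (Inl e) * of_bool (fst e = i)) + (\<Sum>e\<in>E. l (Inl e) * of_bool (snd e = i))"
      by (simp add: sum.distrib[symmetric] distrib_left case_prod_beta)
    finally show ?thesis
      using sum_arcs_tail[OF fE, of "\<lambda>e. l (Inl e)"] sum_arcs_head[OF fE E(2), of "\<lambda>e. l (Inl e)"]
      by (simp add: sum.distrib)
  qed
  \<comment> \<open>At a vertex of \<open>V2\<close> the combination has a positive slack term, so it cannot represent 0.\<close>
  have "t \<noteq> 0"
  proof
    assume "t = 0"
    obtain w where w: "w \<in> V2" using part by auto
    have "0 \<le> (\<Sum>j\<in>E `` {w}. l (Inl (w, j)) + l (Inl (j, w)))"
      using l E(2) by (intro sum_nonneg add_nonneg_nonneg less_imp_le) (auto dest: symD)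
    moreover have "0 < s w" using w l by (auto simp: s_def)
    ultimately show False using split[of w] w part \<open>t = 0\<close> by auto
  qed
  with t have t: "0 < t" by simp
  define \<alpha> where "\<alpha> = (\<lambda>e\<in>E. (l (Inl e) + l (Inl (prod.swap e))) / t)"
  have "\<alpha> \<in> edge_weights E"
    using t l E(2) by (auto simp: \<alpha>_def edge_weights_def add.commute dest: symD
        intro!: divide_pos_pos add_pos_pos)
  moreover have "weight_marginal E \<alpha> i = m i - s i / t" if "i \<in> V" for i
  proof -
    have "weight_marginal E \<alpha> i = (\<Sum>j\<in>E `` {i}. (l (Inl (i, j)) + l (Inl (j, i))) / t)"
      by (auto simp: weight_marginal_def \<alpha>_def intro!: sum.cong)
    also have "\<dots> = (t * m i - s i) / t"
      using split[OF that] by (simp add: sum_divide_distrib)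
    finally show ?thesis using t by (simp add: field_simps)
  qed
  ultimately show ?thesis
    using t l part by (intro bexI[of _ \<alpha>]) (auto simp: s_def intro!: divide_pos_pos)
qed

section \<open>The neighbourhood inequality for a marginal\<close>

lemma connected_closed_eq_pverts:
  assumes "Digraph_Component.connected (with_proj G)"
    and "sym (parcs G)" and "S \<subseteq> pverts G" and "S \<noteq> {}" and "parcs G `` S \<subseteq> S"
  shows "S = pverts G"
proof -
  obtain s where s: "s \<in> S" using assms(4) by auto
  have "v \<in> S" if "v \<in> pverts G" for v
  proof -
    have "s \<rightarrow>\<^sup>*\<^bsub>with_proj (mk_symmetric (with_proj G))\<^esub> v"
      using assms(1,3) s that
      by (auto simp: Digraph_Component.connected_def strongly_connected_def)
    then have "(s, v) \<in> rtrancl_on (pverts G) (parcs (mk_symmetric (with_proj G)))"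
      by (simp add: reachable_def)
    then show "v \<in> S"
    proof (induction rule: rtrancl_on_induct)
      case base
      then show ?case using s by simp
    next
      case (step a b)
      then have "(a, b) \<in> parcs G"
        using assms(2) by (auto simp: parcs_mk_symmetric dest: symD)
      then show ?case using step assms(5) by auto
    qed
  qed
  then show ?thesis using assms(3) by auto
qed

text \<open>
  Both sides count edge weights, the right-hand side up to a defect on \<open>V2\<close>: with \<open>N = E `` U\<close>, the
  arcs from \<open>U\<close> are the reversed arcs from \<open>N\<close> into \<open>U\<close>, so in the absence of strictness no arc
  from \<open>N\<close> leaves \<open>U\<close> and \<open>N\<close> misses \<open>V2\<close>. Then \<open>U \<union> N\<close> is closed under adjacency although it
  misses \<open>V2\<close>.
\<close>

lemma sum_less_neighbours:
  fixes m :: "'a \<Rightarrow> real"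
  assumes V: "finite V" and E: "E \<subseteq> V \<times> V" "sym E"
    and conn: "\<And>S. \<lbrakk>S \<subseteq> V; S \<noteq> {}; E `` S \<subseteq> S\<rbrakk> \<Longrightarrow> S = V"
    and part: "V1 \<inter> V2 = {}" "V1 \<union> V2 = V" "V2 \<noteq> {}"
    and \<alpha>: "\<alpha> \<in> edge_weights E"
    and eq: "\<forall>i\<in>V1. weight_marginal E \<alpha> i = m i"
    and lt: "\<forall>j\<in>V2. weight_marginal E \<alpha> j < m j"
    and U: "U \<subseteq> V1" "U \<noteq> {}"
  shows "sum m U < sum m (E `` U)"
proof -
  let ?N = "E `` U"
  have fin: "finite U" "finite ?N" "\<And>i. finite (E `` {i})"
    using V E(1) U part by (auto intro: finite_subset[of _ V])
  have \<alpha>_pos: "0 < \<alpha> (i, j)" and \<alpha>_sym: "\<alpha> (i, j) = \<alpha> (j, i)" if "(i, j) \<in> E" for i j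
    using \<alpha> that by (auto simp: edge_weights_def PiE_iff)
  define returns where "returns j = (\<Sum>i\<in>E `` {j} \<inter> U. \<alpha> (j, i))" for j
  have "sum m U = (\<Sum>i\<in>U. \<Sum>j\<in>E `` {i}. \<alpha> (i, j))"
    using eq U by (intro sum.cong) (auto simp: weight_marginal_def)
  also have "\<dots> = (\<Sum>i\<in>U. \<Sum>j\<in>{j\<in>?N. (i, j) \<in> E}. \<alpha> (i, j))"
    by (intro sum.cong) auto
  also have "\<dots> = (\<Sum>j\<in>?N. \<Sum>i\<in>{i\<in>U. (i, j) \<in> E}. \<alpha> (i, j))"
    using fin by (intro sum.swap_restrict)
  also have "\<dots> = (\<Sum>j\<in>?N. returns j)"
    unfolding returns_def using E(2) \<alpha>_sym by (intro sum.cong) (auto dest: symD)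
  finally have mU: "sum m U = (\<Sum>j\<in>?N. returns j)" .
  have returns_le: "returns j \<le> weight_marginal E \<alpha> j" for j
    unfolding returns_def weight_marginal_def
    using fin \<alpha>_pos by (intro sum_mono2) (auto intro: less_imp_le)
  have marg_le: "weight_marginal E \<alpha> j \<le> m j" if "j \<in> V" for j
    using that eq lt part by force
  have N_V: "?N \<subseteq> V" using E(1) by auto
  show ?thesis
  proof (rule ccontr)
    assume "\<not> ?thesis"
    then have "(\<Sum>j\<in>?N. m j - returns j) \<le> 0" by (simp add: mU sum_subtractf)
    moreover have nonneg: "0 \<le> m j - returns j" if "j \<in> ?N" for j
      using returns_le[of j] marg_le[of j] N_V that by auto
    ultimately have "(\<Sum>j\<in>?N. m j - returns j) = 0"
      by (intro order_antisym sum_nonneg) auto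
    then have tight: "m j = returns j" if "j \<in> ?N" for j
      using that nonneg fin(2) by (subst (asm) sum_nonneg_eq_0_iff) auto
    have N_V1: "?N \<subseteq> V1"
    proof
      fix j assume j: "j \<in> ?N"
      then have "\<not> weight_marginal E \<alpha> j < m j" using tight[OF j] returns_le[of j] by simp
      then show "j \<in> V1" using j N_V part lt by blast
    qed
    have "E `` ?N \<subseteq> U"
    proof (rule ccontr)
      assume "\<not> E `` ?N \<subseteq> U"
      then obtain j k where jk: "j \<in> ?N" "(j, k) \<in> E" "k \<notin> U" by auto
      have "returns j < weight_marginal E \<alpha> j"
        unfolding returns_def weight_marginal_def
        using fin jk \<alpha>_pos by (intro sum_strict_mono2[of _ _ k]) (auto intro: less_imp_le)
      then show False using tight[OF jk(1)] marg_le[of j] jk(1) N_V by force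
    qed
    then have "U \<union> ?N = V" using U part N_V by (intro conn) auto
    then show False using U N_V1 part by blast
  qed
qed

section \<open>Coincidence of the two sets of measures\<close>

theorem theorem3:
  fixes G :: "'a pair_pre_digraph" and V1 V2 :: "'a set"
  assumes "pair_graph G"
    and "Digraph_Component.connected (with_proj G)"
    and "V1 \<inter> V2 = {}" and "V1 \<noteq> {}" and "V2 \<noteq> {}" and "V1 \<union> V2 = pverts G"
  shows "Ncond G V1 = Wprec G V2"
proof -
  interpret pair_graph G by fact
  let ?V = "pverts G" and ?E = "parcs G"
  have V: "finite ?V" by (rule pair_finite_verts)
  have E: "?E \<subseteq> ?V \<times> ?V" "sym ?E"
    using wellformed' pair_sym_arcs by (auto simp: symmetric_def)
  have compl: "?V - V2 = V1" using assms by auto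
  have meas: "measure \<mu> U = (\<Sum>i\<in>U. measure \<mu> {i})"
    if "\<mu> \<in> full_support_measures ?V" "U \<subseteq> ?V" for \<mu> U
    using that V by (intro finite_measure.finite_measure_eq_sum_singleton)
      (auto simp: full_support_measures_def intro: finite_subset)
  have "(\<forall>U\<subseteq>V1. U \<noteq> {} \<longrightarrow> measure \<mu> U < measure \<mu> (?E `` U)) \<longleftrightarrow>
        (\<exists>\<alpha>\<in>edge_weights ?E. (\<forall>i\<in>V1. weight_marginal ?E \<alpha> i = measure \<mu> {i}) \<and>
          (\<forall>j\<in>V2. weight_marginal ?E \<alpha> j < measure \<mu> {j}))"
    if \<mu>: "\<mu> \<in> full_support_measures ?V" for \<mu>
  proof -
    define m where "m i = measure \<mu> {i}" for i
    have m: "\<forall>i\<in>?V. 0 < m i" using \<mu> by (auto simp: m_def full_support_measures_def)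
    have meas_V1: "measure \<mu> U = sum m U" "measure \<mu> (?E `` U) = sum m (?E `` U)"
      if "U \<subseteq> V1" for U
    proof -
      have "U \<subseteq> ?V" "?E `` U \<subseteq> ?V" using that assms(6) E(1) by auto
      then show "measure \<mu> U = sum m U" "measure \<mu> (?E `` U) = sum m (?E `` U)"
        unfolding m_def by (simp_all only: meas[OF \<mu>])
    qed
    have "(\<forall>U\<subseteq>V1. U \<noteq> {} \<longrightarrow> measure \<mu> U < measure \<mu> (?E `` U)) \<longleftrightarrow>
        (\<forall>U\<subseteq>V1. U \<noteq> {} \<longrightarrow> sum m U < sum m (?E `` U))"
      using meas_V1 by auto
    also have "\<dots> \<longleftrightarrow>
        (\<exists>\<alpha>\<in>edge_weights ?E. (\<forall>i\<in>V1. weight_marginal ?E \<alpha> i = m i) \<and>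
          (\<forall>j\<in>V2. weight_marginal ?E \<alpha> j < m j))" (is "?hall \<longleftrightarrow> ?weights")
    proof
      assume ?hall
      then show ?weights using edge_weights_exist[OF V E m assms(3,6,5)] by blast
    next
      assume ?weights
      then show ?hall
        using sum_less_neighbours[OF V E connected_closed_eq_pverts[OF assms(2) E(2)] assms(3,6,5)]
        by blast
    qed
    finally show ?thesis unfolding m_def .
  qed
  then show ?thesis unfolding Ncond_def Wprec_def compl by blast
qed

end
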